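(* Let $n,k\geq 1$ and let $\psi=(\phi_1,\ldots,\phi_n;\sigma):\mathbb{Z}^k\to (\mathbb{Z}^k)^n\rtimes \Sigma_n$ be a group morphism. If $\phi_i(n_{i\bar z}\bar z)\in n_{i\bar z}\mathbb{Z}^k$ for some $i\in\{1,\ldots,n\}$ and some $\bar z\in\mathbb{Z}^k$ such that $\bar z\notin S_i$, then $\psi$ cannot be induced by an affine $n$-valued map.
   Context: $\Sigma_n$ is the symmetric group on $\{1,\ldots,n\}$. The product in $(\mathbb{Z}^k)^n\rtimes\Sigma_n$ is $(\alpha_1,\ldots,\alpha_n;\sigma)(\beta_1,\ldots,\beta_n;\tau)=(\alpha_1+\beta_{\sigma^{-1}(1)},\ldots,\alpha_n+\beta_{\sigma^{-1}(n)};\sigma\tau)$. A group morphism $\psi:\mathbb{Z}^k\to(\mathbb{Z}^k)^n\rtimes\Sigma_n$ is written $\psi=(\phi_1,\ldots,\phi_n;\sigma)$, meaning $\psi(\bar z)=(\phi_1(\bar z),\ldots,\phi_n(\bar z);\sigma_{\bar z})$; here $\sigma:\bar z\mapsto\sigma_{\bar z}\in\Sigma_n$ is a morphism, and the $\phi_i:\mathbb{Z}^k\to\mathbb{Z}^k$ are maps, not necessarily morphisms. $S_i=\{\bar z\in\mathbb{Z}^k\mid\sigma_{\bar z}(i)=i\}$, and $n_{i\bar z}$ is the length of the cycle containing $i$ in the disjoint cycle decomposition of $\sigma_{\bar z}$ (equal to $1$ if $\sigma_{\bar z}(i)=i$). $T^k$ is the $k$-torus with universal covering $p:\mathbb{R}^k\to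 T^k$, $p(t_1,\ldots,t_k)=(e^{2\pi i t_1},\ldots,e^{2\pi i t_k})$, and covering group $\mathbb{Z}^k$ acting by translations. $D_n(T^k)$ is the space of sets of $n$ distinct points of $T^k$, topologised as the quotient of the ordered configuration space $F_n(T^k)\subseteq (T^k)^n$ by the permutation action of $\Sigma_n$; an $n$-valued map of $T^k$ is a continuous map $f:T^k\to D_n(T^k)$. Let $F_n(\mathbb{R}^k,\mathbb{Z}^k)=\{(\tilde x_1,\ldots,\tilde x_n)\in(\mathbb{R}^k)^n\mid p(\tilde x_i)\neq p(\tilde x_j)\text{ if }i\neq j\}$, with covering map $p^n:F_n(\mathbb{R}^k,\mathbb{Z}^k)\to D_n(T^k)$, $(\tilde x_1,\ldots,\tilde x_n)\mapsto\{p(\tilde x_1),\ldots,p(\tilde x_n)\}$. A lift of $f$ is a continuous map $\tilde f=(\tilde f_1,\ldots,\tilde f_n):\mathbb{R}^k\to F_n(\mathbb{R}^k,\mathbb{Z}^k)$ with $p^n\circ\tilde f=f\circ p$; the maps $\tilde f_i:\mathbb{R}^k\to\mathbb{R}^k$ are its lift-factors. A lift $\tilde f$ induces a unique morphism $\psi_{\tilde f}=(\phi_1,\ldots,\phi_n;\sigma):\mathbb{Z}^k\to(\mathbb{Z}^k)^n\rtimes\Sigma_n$ satisfying $\tilde f_i(\bar t+\bar z)=\tilde f_{(\sigma_{\bar z})^{-1}(i)}(\bar t)+\phi_i(\bar z)$ for all $i$, all $\bar t\in\mathbb{R}^k$ and all $\bar z\in\mathbb{Z}^k$. The map $f$ is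 affine if it has a lift all of whose lift-factors are affine maps $\bar t\mapsto A_i\bar t+\bar a_i$ with $A_i\in\mathbb{R}^{k\times k}$, $\bar a_i\in\mathbb{R}^k$. A morphism $\psi$ is induced by an affine ($n$-valued) map if there is an affine $f:T^k\to D_n(T^k)$ and a lift $\tilde f$ of $f$ with $\psi_{\tilde f}=\psi$. *)

theory Defs
  imports
    "HOL-Analysis.Analysis"
    "HOL-Algebra.Product_Groups"
    "HOL-Algebra.Sym_Groups"
begin

section \<open>The group $(\mathbf{Z}^k)^n \rtimes \Sigma_n$\<close>

text \<open>The dimension k is the cardinality of the index type \<open>'k\<close>. Tuples of length n are
  extensional functions on \<open>{1..n}\<close>, as in \<^const>\<open>product_group\<close>.\<close>

definition lattice_group :: "(int ^ 'k) monoid" where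
  "lattice_group = \<lparr>carrier = UNIV, monoid.mult = (+), one = 0\<rparr>"

type_synonym 'k wreath = "(nat \<Rightarrow> int ^ 'k) \<times> (nat \<Rightarrow> nat)"

definition wreath_group :: "nat \<Rightarrow> ('k::finite) wreath monoid" where
  "wreath_group n =
    \<lparr>carrier = carrier (product_group {1..n} (\<lambda>_. lattice_group)) \<times> carrier (sym_group n),
     monoid.mult = (\<lambda>(\<alpha>, \<sigma>) (\<beta>, \<tau>). (\<lambda>i\<in>{1..n}. \<alpha> i + \<beta> (inv_into UNIV \<sigma> i), \<sigma> \<circ> \<tau>)),
     one = (\<lambda>i\<in>{1..n}. 0, id)\<rparr>"

text \<open>For \<open>\<psi> = (\<phi>\<^sub>1, \<dots>, \<phi>\<^sub>n; \<sigma>)\<close>, \<open>phi \<psi> i\<close> is \<open>\<phi>\<^sub>i\<close> and \<open>sigma_part \<psi> z\<close> is \<open>\<sigma>\<^sub>z\<close>.\<close>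

definition phi :: "(int ^ 'k \<Rightarrow> ('k::finite) wreath) \<Rightarrow> nat \<Rightarrow> int ^ 'k \<Rightarrow> int ^ 'k" where
  "phi \<psi> i z = fst (\<psi> z) i"

definition sigma_part :: "(int ^ 'k \<Rightarrow> ('k::finite) wreath) \<Rightarrow> int ^ 'k \<Rightarrow> nat \<Rightarrow> nat" where
  "sigma_part \<psi> z = snd (\<psi> z)"

definition stab :: "(int ^ 'k \<Rightarrow> ('k::finite) wreath) \<Rightarrow> nat \<Rightarrow> (int ^ 'k) set" where
  "stab \<psi> i = {z. sigma_part \<psi> z i = i}"

text \<open>\<open>support p i\<close> is the cycle \<open>[i, p i, p (p i), \<dots>]\<close> of the permutation p through i,
  as used in \<^theory>\<open>HOL-Combinatorics.Cycles\<close> for the decomposition into disjoint cycles;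
  it is \<open>[i]\<close> if \<open>p i = i\<close>.\<close>

definition cycle_length :: "(int ^ 'k \<Rightarrow> ('k::finite) wreath) \<Rightarrow> nat \<Rightarrow> int ^ 'k \<Rightarrow> nat" where
  "cycle_length \<psi> i z = length (support (sigma_part \<psi> z) i)"


section \<open>Configuration spaces of the torus\<close>

definition torus :: "(complex ^ 'k) set" where
  "torus = {x. \<forall>j. norm (x $ j) = 1}"

definition torus_cover :: "real ^ 'k \<Rightarrow> complex ^ 'k" where
  "torus_cover t = (\<chi> j. exp (2 * pi * \<i> * of_real (t $ j)))"

definition ordered_conf :: "nat \<Rightarrow> (nat \<Rightarrow> complex ^ 'k) topology" where
  "ordered_conf n =
     subtopology (product_topology (\<lambda>_. top_of_set torus) {1..n}) {x. inj_on x {1..n}}"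

text \<open>The orbit of an ordered configuration x under the permutation action is identified with
  the set of its points, so that the orbit map becomes \<open>x \<mapsto> x ` {1..n}\<close>; see
  \<open>quotient_map_conf\<close> below.\<close>

definition conf :: "nat \<Rightarrow> (complex ^ 'k) set topology" where
  "conf n = topology (\<lambda>U. U \<subseteq> {A. A \<subseteq> torus \<and> finite A \<and> card A = n} \<and>
     openin (ordered_conf n) {x \<in> topspace (ordered_conf n). x ` {1..n} \<in> U})"

text \<open>The space \<open>F\<^sub>n(R\<^sup>k, Z\<^sup>k)\<close> and its covering map to \<^term>\<open>conf n\<close>.\<close>

definition cover_conf :: "nat \<Rightarrow> (nat \<Rightarrow> real ^ 'k) topology" where
  "cover_conf n =
     subtopology (product_topology (\<lambda>_. euclidean) {1..n}) {x. inj_on (torus_cover \<circ> x) {1..n}}"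

definition conf_cover :: "nat \<Rightarrow> (nat \<Rightarrow> real ^ 'k) \<Rightarrow> (complex ^ 'k) set" where
  "conf_cover n x = (torus_cover \<circ> x) ` {1..n}"


section \<open>n-valued maps, lifts and induced morphisms\<close>

definition n_valued_map :: "nat \<Rightarrow> (complex ^ 'k \<Rightarrow> (complex ^ 'k) set) \<Rightarrow> bool" where
  "n_valued_map n f \<longleftrightarrow> continuous_map (top_of_set torus) (conf n) f"

text \<open>The lift-factors of F are the maps \<open>\<lambda>t. F t i\<close> for \<open>i \<in> {1..n}\<close>.\<close>

definition is_lift ::
  "nat \<Rightarrow> (complex ^ 'k \<Rightarrow> (complex ^ 'k) set) \<Rightarrow> (real ^ 'k \<Rightarrow> nat \<Rightarrow> real ^ 'k) \<Rightarrow> bool" where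
  "is_lift n f F \<longleftrightarrow>
     continuous_map euclidean (cover_conf n) F \<and> (\<forall>t. conf_cover n (F t) = f (torus_cover t))"

definition real_vec :: "int ^ 'k \<Rightarrow> real ^ 'k" where
  "real_vec z = (\<chi> j. of_int (z $ j))"

text \<open>\<open>lift_morphism n F \<psi>\<close> says that \<open>\<psi>\<close> is the morphism induced by the lift F; there is
  at most one, by \<open>lift_morphism_unique\<close> below.\<close>

definition lift_morphism ::
  "nat \<Rightarrow> (real ^ 'k \<Rightarrow> nat \<Rightarrow> real ^ 'k) \<Rightarrow> (int ^ 'k \<Rightarrow> ('k::finite) wreath) \<Rightarrow> bool" where
  "lift_morphism n F \<psi> \<longleftrightarrow> \<psi> \<in> hom lattice_group (wreath_group n) \<and>
     (\<forall>i\<in>{1..n}. \<forall>t z. F (t + real_vec z) i =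
        F t (inv_into UNIV (sigma_part \<psi> z) i) + real_vec (phi \<psi> i z))"

definition affine_map :: "(real ^ 'k \<Rightarrow> real ^ 'k) \<Rightarrow> bool" where
  "affine_map g \<longleftrightarrow> (\<exists>(A :: real ^ 'k ^ 'k) a. \<forall>t. g t = A *v t + a)"

definition affine_n_valued_map :: "nat \<Rightarrow> (complex ^ 'k \<Rightarrow> (complex ^ 'k) set) \<Rightarrow> bool" where
  "affine_n_valued_map n f \<longleftrightarrow> n_valued_map n f \<and>
     (\<exists>F. is_lift n f F \<and> (\<forall>i\<in>{1..n}. affine_map (\<lambda>t. F t i)))"

text \<open>The lift inducing \<open>\<psi>\<close> is an arbitrary lift of the affine map, not
  necessarily one of those whose factors are required to be affine.\<close>

definition induced_by_affine :: "nat \<Rightarrow> (int ^ 'k \<Rightarrow> ('k::finite) wreath) \<Rightarrow> bool" where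
  "induced_by_affine n \<psi> \<longleftrightarrow>
     (\<exists>f F. affine_n_valued_map n f \<and> is_lift n f F \<and> lift_morphism n F \<psi>)"


section \<open>Consistency of the definitions\<close>

lemma group_wreath_group:
  fixes n :: nat
  shows "group (wreath_group n :: ('k::finite) wreath monoid)"
proof (rule groupI)
  fix x y :: "'k wreath" assume "x \<in> carrier (wreath_group n)" "y \<in> carrier (wreath_group n)"
  then show "x \<otimes>\<^bsub>wreath_group n\<^esub> y \<in> carrier (wreath_group n)"
    by (auto simp: wreath_group_def sym_group_def lattice_group_def intro: permutes_compose)
next
  show "\<one>\<^bsub>wreath_group n\<^esub> \<in> carrier (wreath_group n :: 'k wreath monoid)"
    by (auto simp: wreath_group_def sym_group_def lattice_group_def)
next
  fix x y z :: "'k wreath"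
  assume "x \<in> carrier (wreath_group n)" "y \<in> carrier (wreath_group n)" "z \<in> carrier (wreath_group n)"
  then obtain \<alpha> \<sigma> \<beta> \<tau> \<gamma> \<rho> where eq: "x = (\<alpha>, \<sigma>)" "y = (\<beta>, \<tau>)" "z = (\<gamma>, \<rho>)"
    and p: "\<sigma> permutes {1..n}" "\<tau> permutes {1..n}"
    by (auto simp: wreath_group_def sym_group_def)
  have "inv_into UNIV \<sigma> i \<in> {1..n}" if "i \<in> {1..n}" for i
    using permutes_in_image[OF permutes_inv[OF p(1)]] that by blast
  moreover have "inv_into UNIV (\<sigma> \<circ> \<tau>) = inv_into UNIV \<tau> \<circ> inv_into UNIV \<sigma>"
    using p by (simp add: o_inv_distrib permutes_bij)
  ultimately show "x \<otimes>\<^bsub>wreath_group n\<^esub> y \<otimes>\<^bsub>wreath_group n\<^esub> z =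
      x \<otimes>\<^bsub>wreath_group n\<^esub> (y \<otimes>\<^bsub>wreath_group n\<^esub> z)"
    by (auto simp: wreath_group_def eq fun_eq_iff add.assoc restrict_def)
next
  fix x :: "'k wreath" assume "x \<in> carrier (wreath_group n)"
  then show "\<one>\<^bsub>wreath_group n\<^esub> \<otimes>\<^bsub>wreath_group n\<^esub> x = x"
    by (auto simp: wreath_group_def lattice_group_def fun_eq_iff PiE_iff extensional_def)
next
  fix x :: "'k wreath" assume "x \<in> carrier (wreath_group n)"
  then obtain \<alpha> \<sigma> where eq: "x = (\<alpha>, \<sigma>)" and p: "\<sigma> permutes {1..n}"
    by (auto simp: wreath_group_def sym_group_def)
  let ?y = "(\<lambda>i\<in>{1..n}. - \<alpha> (\<sigma> i), inv_into UNIV \<sigma>)"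
  have "?y \<in> carrier (wreath_group n)"
    using permutes_inv[OF p] by (auto simp: wreath_group_def sym_group_def lattice_group_def)
  moreover have "?y \<otimes>\<^bsub>wreath_group n\<^esub> x = \<one>\<^bsub>wreath_group n\<^esub>"
    using p by (auto simp: wreath_group_def eq fun_eq_iff permutes_inv_o permutes_inv_inv
        restrict_def permutes_inverses)
  ultimately show "\<exists>y\<in>carrier (wreath_group n). y \<otimes>\<^bsub>wreath_group n\<^esub> x = \<one>\<^bsub>wreath_group n\<^esub>"
    by blast
qed

lemma topspace_ordered_conf:
  "topspace (ordered_conf n) = {x \<in> {1..n} \<rightarrow>\<^sub>E torus. inj_on x {1..n}}"
  by (auto simp: ordered_conf_def)

lemma openin_conf:
  fixes U :: "(complex ^ 'k) set set"
  shows "openin (conf n) U \<longleftrightarrow> U \<subseteq> {A. A \<subseteq> torus \<and> finite A \<and> card A = n} \<and>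
     openin (ordered_conf n) {x \<in> topspace (ordered_conf n). x ` {1..n} \<in> U}"
proof -
  let ?D = "{A :: (complex ^ 'k) set. A \<subseteq> torus \<and> finite A \<and> card A = n}"
  let ?P = "\<lambda>U :: (complex ^ 'k) set set.
    openin (ordered_conf n) {x \<in> topspace (ordered_conf n). x ` {1..n} \<in> U}"
  have 1: "?P (S \<inter> T)" if "?P S" "?P T" for S T
    using openin_Int[OF that] by (rule back_subst[of "openin _"]) auto
  have 2: "?P (\<Union>K)" if "\<forall>S\<in>K. ?P S" for K
  proof -
    have "openin (ordered_conf n)
        (\<Union>S\<in>K. {x \<in> topspace (ordered_conf n). x ` {1..n} \<in> S})"
      using that by blast
    then show ?thesis by (rule back_subst[of "openin _"]) auto
  qed
  have "istopology (\<lambda>U. U \<subseteq> ?D \<and> ?P U)"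
    unfolding istopology_def
  proof (intro conjI allI impI)
    fix S T :: "(complex ^ 'k) set set"
    assume S: "S \<subseteq> ?D \<and> ?P S" and T: "T \<subseteq> ?D \<and> ?P T"
    then show "S \<inter> T \<subseteq> ?D" by blast
    from S T show "?P (S \<inter> T)" by (intro 1) simp_all
  next
    fix K :: "(complex ^ 'k) set set set"
    assume K: "\<forall>S\<in>K. S \<subseteq> ?D \<and> ?P S"
    then show "\<Union>K \<subseteq> ?D" by blast
    from K show "?P (\<Union>K)" by (intro 2) simp
  qed
  from topology_inverse'[OF this] show ?thesis
    unfolding conf_def by simp
qed

lemma conf_image:
  "(\<lambda>x. x ` {1..n}) ` topspace (ordered_conf n) = {A :: (complex ^ 'k) set. A \<subseteq> torus \<and> finite A \<and> card A = n}"
proof (intro equalityI subsetI)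
  fix A :: "(complex ^ 'k) set" assume "A \<in> (\<lambda>x. x ` {1..n}) ` topspace (ordered_conf n)"
  then show "A \<in> {A. A \<subseteq> torus \<and> finite A \<and> card A = n}"
    by (auto simp: topspace_ordered_conf card_image PiE_iff)
next
  fix A :: "(complex ^ 'k) set" assume A: "A \<in> {A. A \<subseteq> torus \<and> finite A \<and> card A = n}"
  then obtain h where h: "bij_betw h {1..n} A"
    using finite_same_card_bij[of "{1..n}" A] by auto
  then have "restrict h {1..n} \<in> topspace (ordered_conf n)"
  proof -
    have "inj_on (restrict h {1..n}) {1..n}"
      using bij_betw_imp_inj_on[OF h] by (rule inj_on_cong[THEN iffD1, rotated]) simp
    moreover have "restrict h {1..n} \<in> {1..n} \<rightarrow>\<^sub>E torus"
      using A bij_betwE[OF h] by (auto simp del: One_nat_def)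
    ultimately show ?thesis
      unfolding topspace_ordered_conf by blast
  qed
  moreover have "A = restrict h {1..n} ` {1..n}"
    using bij_betw_imp_surj_on[OF h] by simp
  ultimately show "A \<in> (\<lambda>x. x ` {1..n}) ` topspace (ordered_conf n)"
    by blast
qed

lemma topspace_conf:
  "topspace (conf n) = {A :: (complex ^ 'k) set. A \<subseteq> torus \<and> finite A \<and> card A = n}"
proof
  show "topspace (conf n) \<subseteq> {A :: (complex ^ 'k) set. A \<subseteq> torus \<and> finite A \<and> card A = n}"
    using openin_topspace[of "conf n :: (complex ^ 'k) set topology"] unfolding openin_conf by blast
  have "{x \<in> topspace (ordered_conf n). x ` {1..n} \<in> {A. A \<subseteq> torus \<and> finite A \<and> card A = n}}
      = topspace (ordered_conf n :: (nat \<Rightarrow> complex ^ 'k) topology)"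
    using conf_image[of n] by blast
  then have "openin (conf n) {A :: (complex ^ 'k) set. A \<subseteq> torus \<and> finite A \<and> card A = n}"
    unfolding openin_conf by (metis (no_types, lifting) openin_topspace subset_refl)
  then show "{A. A \<subseteq> torus \<and> finite A \<and> card A = n}
      \<subseteq> topspace (conf n :: (complex ^ 'k) set topology)"
    by (rule openin_subset)
qed

lemma quotient_map_conf: "quotient_map (ordered_conf n) (conf n) (\<lambda>x. x ` {1..n})"
  unfolding quotient_map_def topspace_conf conf_image by (simp add: openin_conf)

text \<open>The fibres of this quotient map are exactly the orbits of the permutation action.\<close>

lemma conf_fibres:
  assumes "x \<in> topspace (ordered_conf n)" "y \<in> topspace (ordered_conf n)"
  shows "x ` {1..n} = y ` {1..n} \<longleftrightarrow> (\<exists>\<sigma>. \<sigma> permutes {1..n} \<and> y = x \<circ> \<sigma>)"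
proof
  have x: "x \<in> {1..n} \<rightarrow>\<^sub>E torus" "inj_on x {1..n}" and y: "y \<in> {1..n} \<rightarrow>\<^sub>E torus" "inj_on y {1..n}"
    using assms by (auto simp: topspace_ordered_conf)
  assume eq: "x ` {1..n} = y ` {1..n}"
  define \<sigma> where "\<sigma> i = (if i \<in> {1..n} then the_inv_into {1..n} x (y i) else i)" for i
  have "bij_betw (the_inv_into {1..n} x \<circ> y) {1..n} {1..n}"
    by (rule bij_betw_trans[where B = "y ` {1..n}"])
       (use x(2) y(2) eq bij_betw_the_inv_into[of x "{1..n}" "y ` {1..n}"] in
         \<open>simp_all add: bij_betw_def\<close>)
  then have "bij_betw \<sigma> {1..n} {1..n}"
    by (rule bij_betw_cong[THEN iffD1, rotated]) (simp add: \<sigma>_def)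
  then have "\<sigma> permutes {1..n}"
    by (rule bij_imp_permutes) (auto simp: \<sigma>_def)
  moreover have "y i = x (\<sigma> i)" for i
  proof (cases "i \<in> {1..n}")
    case True
    then have "y i \<in> x ` {1..n}" using eq by blast
    with True x(2) show ?thesis by (simp add: \<sigma>_def f_the_inv_into_f)
  next
    case False
    then show ?thesis using x(1) y(1) unfolding \<sigma>_def PiE_iff extensional_def by auto
  qed
  ultimately show "\<exists>\<sigma>. \<sigma> permutes {1..n} \<and> y = x \<circ> \<sigma>"
    by (intro exI[of _ \<sigma>]) (simp add: fun_eq_iff)
next
  assume "\<exists>\<sigma>. \<sigma> permutes {1..n} \<and> y = x \<circ> \<sigma>"
  then show "x ` {1..n} = y ` {1..n}"
    by (metis image_comp permutes_image)
qed

lemma torus_cover_eq_iff: "torus_cover s = torus_cover t \<longleftrightarrow> (\<exists>z. s = t + real_vec z)"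
proof
  assume "torus_cover s = torus_cover t"
  then have "\<forall>j. \<exists>m::int. s $ j = t $ j + of_int m"
  proof (intro allI)
    fix j
    assume "torus_cover s = torus_cover t"
    then have "exp (2 * pi * \<i> * of_real (s $ j)) = exp (2 * pi * \<i> * of_real (t $ j))"
      by (simp add: torus_cover_def vec_eq_iff)
    then obtain m :: int where
      "2 * pi * \<i> * of_real (s $ j) = 2 * pi * \<i> * of_real (t $ j) + (of_int (2 * m) * pi) * \<i>"
      unfolding exp_eq by blast
    then have "2 * pi * \<i> * of_real (s $ j) = 2 * pi * \<i> * of_real (t $ j + of_int m)"
      by (simp add: algebra_simps)
    then have "s $ j = t $ j + of_int m"
      unfolding mult_cancel_left of_real_eq_iff by simp
    then show "\<exists>m::int. s $ j = t $ j + of_int m" ..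
  qed
  then obtain m where "\<forall>j. s $ j = t $ j + of_int (m j)" by metis
  then have "s = t + real_vec (\<chi> j. m j)"
    by (simp add: vec_eq_iff real_vec_def)
  then show "\<exists>z. s = t + real_vec z" ..
next
  assume "\<exists>z. s = t + real_vec z"
  then obtain z where z: "s = t + real_vec z" ..
  have "exp (2 * pi * \<i> * of_real (s $ j)) = exp (2 * pi * \<i> * of_real (t $ j))" for j
    unfolding exp_eq z by (rule exI[of _ "z $ j"]) (simp add: real_vec_def algebra_simps)
  then show "torus_cover s = torus_cover t"
    by (simp add: torus_cover_def)
qed

lemma real_vec_eq_iff [simp]: "real_vec z = real_vec w \<longleftrightarrow> z = w"
  by (simp add: real_vec_def vec_eq_iff)

lemma lift_morphism_unique:
  assumes F: "is_lift n f F" and \<psi>: "lift_morphism n F \<psi>" and \<psi>': "lift_morphism n F \<psi>'"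
  shows "\<psi> = \<psi>'"
proof
  fix z
  have C: "\<psi> z \<in> carrier (wreath_group n)" "\<psi>' z \<in> carrier (wreath_group n)"
    using \<psi> \<psi>' by (auto simp: lift_morphism_def hom_def lattice_group_def)
  then have p: "sigma_part \<psi> z permutes {1..n}" "sigma_part \<psi>' z permutes {1..n}"
    by (auto simp: wreath_group_def sym_group_def sigma_part_def)
  have inj: "inj_on (torus_cover \<circ> F 0) {1..n}"
    using F by (auto simp: is_lift_def cover_conf_def continuous_map_in_subtopology)
  let ?s = "inv_into UNIV (sigma_part \<psi> z)" and ?s' = "inv_into UNIV (sigma_part \<psi>' z)"
  have *: "?s i = ?s' i \<and> phi \<psi> i z = phi \<psi>' i z" if i: "i \<in> {1..n}" for i
  proof -
    have "F (0 + real_vec z) i = F 0 (?s i) + real_vec (phi \<psi> i z)"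
         "F (0 + real_vec z) i = F 0 (?s' i) + real_vec (phi \<psi>' i z)"
      using \<psi> \<psi>' i unfolding lift_morphism_def by blast+
    then have eq: "F 0 (?s i) + real_vec (phi \<psi> i z) = F 0 (?s' i) + real_vec (phi \<psi>' i z)"
      by simp
    then have "torus_cover (F 0 (?s i)) = torus_cover (F 0 (?s' i))"
      by (metis torus_cover_eq_iff)
    moreover have "?s i \<in> {1..n}" "?s' i \<in> {1..n}"
      using permutes_in_image[OF permutes_inv[OF p(1)]] permutes_in_image[OF permutes_inv[OF p(2)]] i
      by blast+
    ultimately have "?s i = ?s' i"
      using inj_onD[OF inj] by simp
    with eq show ?thesis by simp
  qed
  have "?s = ?s'"
  proof
    fix i show "?s i = ?s' i"
      using * permutes_inv[OF p(1)] permutes_inv[OF p(2)]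
      by (cases "i \<in> {1..n}") (auto simp: permutes_def)
  qed
  then have "sigma_part \<psi> z = sigma_part \<psi>' z"
    using p by (metis permutes_inv_inv)
  moreover have "fst (\<psi> z) = fst (\<psi>' z)"
    by (rule extensionalityI[of _ "{1..n}"])
       (use C * in \<open>auto simp: wreath_group_def PiE_iff phi_def\<close>)
  ultimately show "\<psi> z = \<psi>' z"
    by (simp add: sigma_part_def prod_eq_iff)
qed

end

theory Submission
  imports Defs
begin

text \<open>Suppose a lift \<open>F\<close> of an affine map induces \<open>\<psi>\<close>. Two lifts of the same map differ,
  factor by factor, by a change of index and an integer translation, because a continuous choice
  of index and translation over the connected space \<open>R\<^sup>k\<close> is constant
  (\<open>lift_factor_eq_translate\<close>). Hence the factors of \<open>F\<close> itself are affine, say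
  \<open>F\<^sub>i(t) = A t + a\<close>.

  Let \<open>m\<close> be the length of the cycle of \<open>\<sigma>\<^sub>z\<close> through \<open>i\<close>. Since \<open>\<sigma>\<close> is a morphism, the
  permutation attached to \<open>m z\<close> fixes \<open>i\<close>, so that translating by \<open>m z\<close> adds
  \<open>\<phi>\<^sub>i(m z)\<close> to \<open>F\<^sub>i\<close>; that is, \<open>m A z = \<phi>\<^sub>i(m z)\<close>. If the right-hand side is \<open>m w\<close> with \<open>w\<close>
  an integer vector, then \<open>A z = w\<close>. Translating by \<open>z\<close> itself now gives
  \<open>F\<^sub>i(0) + w = F\<^sub>j(0) + \<phi>\<^sub>i(z)\<close> with \<open>j = \<sigma>\<^sub>z\<^sup>-\<^sup>1(i)\<close>, so that \<open>F\<^sub>i(0)\<close> and \<open>F\<^sub>j(0)\<close> lie over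
  the same point of the torus. The factors of a lift never do so for different indices, whence
  \<open>\<sigma>\<^sub>z\<close> fixes \<open>i\<close>.\<close>

lemma real_vec_diff: "real_vec (z - w) = real_vec z - real_vec w"
  by (simp add: real_vec_def vec_eq_iff)

lemma real_vec_of_nat_mult: "real_vec (int m *s z) = real m *\<^sub>R real_vec z"
  by (simp add: real_vec_def vec_eq_iff)

lemma continuous_on_torus_cover: "continuous_on S torus_cover"
  unfolding torus_cover_def by (intro continuous_on_vec_lambda continuous_intros)

lemma is_lift_continuous:
  assumes "is_lift n f F" "i \<in> {1..n}"
  shows "continuous_on UNIV (\<lambda>t. F t i)"
proof -
  have "continuous_map euclidean (product_topology (\<lambda>_. euclidean) {1..n}) F"
    using assms(1) by (simp add: is_lift_def cover_conf_def continuous_map_in_subtopology)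
  then show ?thesis
    using assms(2) by (simp add: continuous_map_componentwise)
qed

lemma is_lift_inj:
  assumes "is_lift n f F"
  shows "inj_on (\<lambda>i. torus_cover (F t i)) {1..n}"
proof -
  have "\<forall>t. inj_on (torus_cover \<circ> F t) {1..n}"
    using assms by (auto simp: is_lift_def cover_conf_def continuous_map_in_subtopology)
  then show ?thesis by (simp add: comp_def)
qed

text \<open>At each \<open>t\<close> the factor \<open>F\<^sub>i\<close> lies over exactly one of the \<open>n\<close> points \<open>p(G\<^sub>j(t))\<close>. The sets
  where a given \<open>j\<close> occurs are closed, disjoint and finite in number, so by connectedness one \<open>j\<close>
  serves for all \<open>t\<close>; then \<open>F\<^sub>i - G\<^sub>j\<close> is continuous with values in the discrete set of integer
  vectors, hence constant.\<close>

lemma lift_factor_eq_translate: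
  fixes F G :: "real ^ 'k \<Rightarrow> nat \<Rightarrow> real ^ 'k"
  assumes F: "is_lift n f F" and G: "is_lift n f G" and i: "i \<in> {1..n}"
  obtains j z where "j \<in> {1..n}" "\<And>t. F t i = G t j + real_vec z"
proof -
  define C where "C j = {t. torus_cover (F t i) = torus_cover (G t j)}" for j
  have closed: "closed (C j)" if "j \<in> {1..n}" for j
    unfolding C_def
    using is_lift_continuous[OF F i] is_lift_continuous[OF G that]
    by (intro closed_Collect_eq)
       (auto intro!: continuous_on_compose2[OF continuous_on_torus_cover[of UNIV]])
  have cover: "\<exists>j\<in>{1..n}. t \<in> C j" for t
  proof -
    have "torus_cover (F t i) \<in> conf_cover n (G t)"
      using F G i unfolding is_lift_def by (metis conf_cover_def comp_apply image_eqI)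
    then show ?thesis by (auto simp: conf_cover_def C_def)
  qed
  have disjoint: "j = l" if "t \<in> C j" "t \<in> C l" "j \<in> {1..n}" "l \<in> {1..n}" for t j l
    using inj_onD[OF is_lift_inj[OF G]] that by (simp add: C_def)
  obtain j where j: "j \<in> {1..n}" "0 \<in> C j" using cover by blast
  define B where "B = (\<Union>l\<in>{1..n} - {j}. C l)"
  have "closed B" unfolding B_def using closed by (intro closed_UN) auto
  moreover have "C j \<inter> B = {}" using disjoint j(1) by (fastforce simp: B_def)
  moreover have "UNIV \<subseteq> C j \<union> B" using cover by (fastforce simp: B_def)
  ultimately have "B = {}"
    using connected_UNIV[where 'a = "real ^ 'k"] closed[OF j(1)] j(2)
    unfolding connected_closed by (metis Int_UNIV_right inf_bot_left empty_iff)
  with \<open>UNIV \<subseteq> C j \<union> B\<close> have all: "t \<in> C j" for t by blast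
  have int: "\<exists>z. F t i - G t j = real_vec z" for t
    using all[of t] by (auto simp: C_def torus_cover_eq_iff)
  have "(\<lambda>t. (F t i - G t j) $ l) constant_on UNIV" for l
  proof (rule continuous_discrete_range_constant)
    show "continuous_on UNIV (\<lambda>t. (F t i - G t j) $ l)"
      using is_lift_continuous[OF F i] is_lift_continuous[OF G j(1)] by (intro continuous_intros)
    have Ints: "(F t i - G t j) $ l \<in> \<int>" for t
    proof -
      obtain z where "F t i - G t j = real_vec z" using int by blast
      then show ?thesis by (simp add: real_vec_def)
    qed
    have "1 \<le> norm ((F y i - G y j) $ l - (F x i - G x j) $ l)"
      if "(F y i - G y j) $ l \<noteq> (F x i - G x j) $ l" for x y
      unfolding real_norm_def
      by (rule Ints_nonzero_abs_ge1[OF Ints_diff[OF Ints Ints]]) (use that in simp)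
    then show "\<exists>e>0. \<forall>y. y \<in> UNIV \<and> (F y i - G y j) $ l \<noteq> (F x i - G x j) $ l \<longrightarrow>
        e \<le> norm ((F y i - G y j) $ l - (F x i - G x j) $ l)" for x
      by (intro exI[of _ 1]) simp
  qed (rule connected_UNIV)
  then have "(F t i - G t j) $ l = (F 0 i - G 0 j) $ l" for t l
    unfolding constant_on_def by (metis UNIV_I)
  then have c: "F t i - G t j = F 0 i - G 0 j" for t
    by (simp add: vec_eq_iff)
  obtain z where "F 0 i - G 0 j = real_vec z" using int by blast
  with c have "F t i = G t j + real_vec z" for t
    by (metis add.commute diff_add_cancel)
  with j(1) show ?thesis by (rule that)
qed

text \<open>Affineness is only given for some lift of \<open>f\<close>; since a change of index and an integer translation keep a
  factor affine, it passes to every lift.\<close>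

lemma lift_of_affine_n_valued_map:
  assumes "affine_n_valued_map n f" "is_lift n f F" "i \<in> {1..n}"
  shows "affine_map (\<lambda>t. F t i)"
proof -
  obtain G where G: "is_lift n f G" "\<forall>j\<in>{1..n}. affine_map (\<lambda>t. G t j)"
    using assms(1) by (auto simp: affine_n_valued_map_def)
  obtain j z where jz: "j \<in> {1..n}" "\<And>t. F t i = G t j + real_vec z"
    using lift_factor_eq_translate[OF assms(2) G(1) assms(3)] by blast
  then obtain A a where "\<forall>t. G t j = A *v t + a"
    using G(2) unfolding affine_map_def by blast
  then have "\<forall>t. F t i = A *v t + (a + real_vec z)" by (simp add: jz(2))
  then show ?thesis unfolding affine_map_def by blast
qed

lemma sigma_part_permutes:
  assumes "\<psi> \<in> hom lattice_group (wreath_group n)"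
  shows "sigma_part \<psi> z permutes {1..n}"
proof -
  have "\<psi> z \<in> carrier (wreath_group n)"
    using assms by (auto simp: hom_def lattice_group_def)
  then show ?thesis
    by (auto simp: wreath_group_def sym_group_def sigma_part_def)
qed

lemma sigma_part_add:
  assumes "\<psi> \<in> hom lattice_group (wreath_group n)"
  shows "sigma_part \<psi> (z + w) = sigma_part \<psi> z \<circ> sigma_part \<psi> w"
proof -
  have "\<psi> (z + w) = \<psi> z \<otimes>\<^bsub>wreath_group n\<^esub> \<psi> w"
    using assms by (auto simp: hom_def lattice_group_def)
  then show ?thesis by (simp add: sigma_part_def wreath_group_def split: prod.splits)
qed

lemma sigma_part_of_nat_mult:
  assumes "\<psi> \<in> hom lattice_group (wreath_group n)"
  shows "sigma_part \<psi> (int m *s z) = sigma_part \<psi> z ^^ m"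
proof (induction m)
  case 0
  \<comment> \<open>An idempotent permutation is the identity.\<close>
  have "sigma_part \<psi> 0 \<circ> sigma_part \<psi> 0 = sigma_part \<psi> 0"
    using sigma_part_add[OF assms, of 0 0] by simp
  then have "sigma_part \<psi> 0 = id"
    using permutes_inv_o(2)[OF sigma_part_permutes[OF assms, of 0]] by (metis comp_assoc comp_id id_comp)
  then show ?case by (simp add: id_def)
next
  case (Suc m)
  have "int (Suc m) *s z = z + int m *s z" by (simp add: vec_eq_iff algebra_simps)
  then show ?case using Suc sigma_part_add[OF assms] by simp
qed

lemma cycle_length_pos:
  assumes "\<psi> \<in> hom lattice_group (wreath_group n)"
  shows "0 < cycle_length \<psi> i z"
proof -
  have "permutation (sigma_part \<psi> z)"
    using sigma_part_permutes[OF assms] permutation_permutes by blast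
  then show ?thesis by (simp add: cycle_length_def least_power_of_permutation(2))
qed

lemma cycle_length_mult_in_stab:
  assumes "\<psi> \<in> hom lattice_group (wreath_group n)"
  shows "int (cycle_length \<psi> i z) *s z \<in> stab \<psi> i"
proof -
  have "permutation (sigma_part \<psi> z)"
    using sigma_part_permutes[OF assms] permutation_permutes by blast
  then show ?thesis
    by (simp add: stab_def sigma_part_of_nat_mult[OF assms] cycle_length_def
        least_power_of_permutation(1))
qed

text \<open>When \<open>\<sigma>\<^sub>z\<close> fixes \<open>i\<close>, translation by \<open>z\<close> relates \<open>F\<^sub>i\<close> to itself, and the constant
  term cancels.\<close>

lemma phi_eq_linear_part:
  assumes "lift_morphism n F \<psi>" "i \<in> {1..n}" "z \<in> stab \<psi> i" "\<And>t. F t i = A *v t + a"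
  shows "real_vec (phi \<psi> i z) = A *v real_vec z"
proof -
  have p: "sigma_part \<psi> z permutes {1..n}"
    using assms(1) by (intro sigma_part_permutes) (simp add: lift_morphism_def)
  have "inv_into UNIV (sigma_part \<psi> z) i = i"
    using assms(3) by (simp add: stab_def permutes_inv_eq[OF p])
  moreover have "F (0 + real_vec z) i
      = F 0 (inv_into UNIV (sigma_part \<psi> z) i) + real_vec (phi \<psi> i z)"
    using assms(1,2) unfolding lift_morphism_def by blast
  ultimately show ?thesis by (simp add: assms(4))
qed

text \<open>If the linear part of \<open>F\<^sub>i\<close> sends \<open>z\<close> to an integer vector, then \<open>F\<^sub>i(0)\<close> and
  \<open>F\<^sub>i(z)\<close> lie over the same point, and so do \<open>F\<^sub>i(0)\<close> and \<open>F\<^sub>j(0)\<close> for \<open>j = \<sigma>\<^sub>z\<^sup>-\<^sup>1(i)\<close>.\<close>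

lemma integral_linear_part_imp_mem_stab:
  assumes lift: "is_lift n f F" and \<psi>: "lift_morphism n F \<psi>" and i: "i \<in> {1..n}"
    and aff: "\<And>t. F t i = A *v t + a" and w: "A *v real_vec z = real_vec w"
  shows "z \<in> stab \<psi> i"
proof -
  let ?j = "inv_into UNIV (sigma_part \<psi> z) i"
  have p: "sigma_part \<psi> z permutes {1..n}"
    using \<psi> by (intro sigma_part_permutes) (simp add: lift_morphism_def)
  have j: "?j \<in> {1..n}"
    using permutes_in_image[OF permutes_inv[OF p]] i by blast
  have "F (0 + real_vec z) i = F 0 ?j + real_vec (phi \<psi> i z)"
    using \<psi> i unfolding lift_morphism_def by blast
  then have "F 0 ?j = F 0 i + real_vec (w - phi \<psi> i z)"
    by (simp add: aff w real_vec_diff algebra_simps)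
  then have "torus_cover (F 0 ?j) = torus_cover (F 0 i)"
    using torus_cover_eq_iff by blast
  then have "?j = i"
    using inj_onD[OF is_lift_inj[OF lift, of 0]] i j by simp
  then show ?thesis by (simp add: stab_def permutes_inv_eq[OF p])
qed

theorem theorem2p6:
  fixes n :: nat and \<psi> :: "int ^ 'k \<Rightarrow> ('k::finite) wreath"
  assumes "n \<ge> 1"
    and "\<psi> \<in> hom lattice_group (wreath_group n)"
    and "\<exists>i\<in>{1..n}. \<exists>z. z \<notin> stab \<psi> i \<and>
           phi \<psi> i (int (cycle_length \<psi> i z) *s z) \<in> range (\<lambda>w. int (cycle_length \<psi> i z) *s w)"
  shows "\<not> induced_by_affine n \<psi>"
proof
  assume "induced_by_affine n \<psi>"
  then obtain f F where f: "affine_n_valued_map n f" and F: "is_lift n f F"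
    and \<psi>: "lift_morphism n F \<psi>"
    by (auto simp: induced_by_affine_def)
  obtain i z w where i: "i \<in> {1..n}" and z: "z \<notin> stab \<psi> i"
    and w: "phi \<psi> i (int (cycle_length \<psi> i z) *s z) = int (cycle_length \<psi> i z) *s w"
    using assms(3) by blast
  obtain A a where aff: "\<And>t. F t i = A *v t + a"
    using lift_of_affine_n_valued_map[OF f F i] unfolding affine_map_def by blast
  define m where "m = cycle_length \<psi> i z"
  have "real m *\<^sub>R (A *v real_vec z) = A *v real_vec (int m *s z)"
    by (simp add: real_vec_of_nat_mult matrix_vector_mult_scaleR)
  also have "\<dots> = real_vec (phi \<psi> i (int m *s z))"
    unfolding m_def
    using phi_eq_linear_part[OF \<psi> i cycle_length_mult_in_stab[OF assms(2)] aff] by simp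
  also have "\<dots> = real m *\<^sub>R real_vec w"
    using w by (simp add: m_def real_vec_of_nat_mult)
  finally have "A *v real_vec z = real_vec w"
    using cycle_length_pos[OF assms(2), of i z] by (simp add: m_def)
  then have "z \<in> stab \<psi> i"
    by (rule integral_linear_part_imp_mem_stab[OF F \<psi> i aff])
  with z show False ..
qed

end
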